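(* For every diagram $D$, \[\mathrm{MC}(D)=\sum_{(r,c)\in D}\mathrm{room}_D(r,c).\]
   Context: A diagram is a finite subset $D\subset\mathbb{Z}_{>0}\times\mathbb{Z}_{>0}$; an element $(r,c)\in D$ is called a cell in row $r$ and column $c$. For $r\in\mathbb{Z}_{>0}$, the Kohnert move at row $r$ is defined as follows: if row $r$ of $D$ contains no cell, $\mathcal{K}(D,r)=D$; otherwise let $(r,c)$ be the cell of $D$ in row $r$ with the largest column index; if there is some $r'<r$ with $(r',c)\notin D$, let $r'$ be the largest such and set $\mathcal{K}(D,r)=(D\setminus\{(r,c)\})\cup\{(r',c)\}$; otherwise $\mathcal{K}(D,r)=D$. The move is nontrivial if $\mathcal{K}(D,r)\neq D$. Let $\mathrm{KD}(D)$ be the set of diagrams obtainable from $D$ by applying a (possibly empty) finite sequence of Kohnert moves, and $\mathrm{Min}(D)=\{\tilde D\in\mathrm{KD}(D): \mathcal{K}(\tilde D,r)=\tilde D \text{ for all } r\}$. $\mathrm{MC}(D)$ is the maximum, over all $\tilde D\in\mathrm{Min}(D)$, of the number $n$ of moves in a sequence of rows $(r_1,\dots,r_n)$ such that, with $D_0=D$ and $D_i=\mathcal{K}(D_{i-1},r_i)$, every move is nontrivial ($D_{i-1}\neq D_i$) and $D_n=\tilde D$. For a cell $(r,c)\in D$ and $\tilde c>0$, let $\mathrm{blockers}_{D,\tilde c}(r,c)=\{(\tilde r,\tilde c)\in D : \tilde r\le r\}$, and define $\mathrm{room}_D(r,c)=r-\max_{\tilde c\ge c}|\mathrm{blockers}_{D,\tilde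 c}(r,c)|$. *)

theory Defs
  imports Main
begin

type_synonym cell = "nat \<times> nat"  \<comment> \<open>(row, column)\<close>

definition diagram :: "cell set \<Rightarrow> bool" where
  "diagram D \<longleftrightarrow> finite D \<and> D \<subseteq> {0<..} \<times> {0<..}"

definition kohnert_move :: "cell set \<Rightarrow> nat \<Rightarrow> cell set" where
  "kohnert_move D r =
     (if {c. (r, c) \<in> D} = {} then D
      else let c = Max {c. (r, c) \<in> D};
               free = {r'. 0 < r' \<and> r' < r \<and> (r', c) \<notin> D}
           in if free = {} then D
              else (D - {(r, c)}) \<union> {(Max free, c)})"

definition KD :: "cell set \<Rightarrow> cell set set" where
  "KD D = {foldl kohnert_move D rs | rs. set rs \<subseteq> {0<..}}"

definition Min_diagrams :: "cell set \<Rightarrow> cell set set" where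
  "Min_diagrams D = {E \<in> KD D. \<forall>r>0. kohnert_move E r = E}"

fun nontrivial_moves :: "cell set \<Rightarrow> nat list \<Rightarrow> bool" where
  "nontrivial_moves D [] \<longleftrightarrow> True"
| "nontrivial_moves D (r # rs) \<longleftrightarrow>
     0 < r \<and> kohnert_move D r \<noteq> D \<and> nontrivial_moves (kohnert_move D r) rs"

text \<open>For a diagram, the set below is finite (every nontrivial move lowers the sum of the row
  indices) and nonempty, so the maximum is genuine.\<close>

definition MC :: "cell set \<Rightarrow> nat" where
  "MC D = Max {length rs | rs. nontrivial_moves D rs \<and> foldl kohnert_move D rs \<in> Min_diagrams D}"

definition blockers :: "cell set \<Rightarrow> nat \<Rightarrow> cell \<Rightarrow> cell set" where
  "blockers D c' = (\<lambda>(r, c). {(r', c'') \<in> D. c'' = c' \<and> r' \<le> r})"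

text \<open>Only finitely many values occur under the maximum, since each is at most the size of the
  diagram.\<close>

definition room :: "cell set \<Rightarrow> cell \<Rightarrow> int" where
  "room D = (\<lambda>(r, c). int r - int (Max {card (blockers D c' (r, c)) | c'. c \<le> c'}))"

end

theory Submission
  imports Defs
begin

text \<open>
  The total room is a potential function. A nontrivial move at row \<open>r\<close> never increases the room of
  a stationary cell, and strictly decreases that of the moving cell: row \<open>r\<close> is empty to the right
  of it, so the columns there contribute at most \<open>r - r' - 1\<close> blockers between the new row \<open>r'\<close> and
  \<open>r\<close>. Hence the total room bounds the number of moves. Conversely, moving at the lowest row
  admitting a nontrivial move loses exactly one unit: all cells below that row have room zero, since
  the last cell of an immovable row sits on top of a full column. When no move is possible, the
  total room is zero.
\<close>

section \<open>Column counts and their relation to room\<close>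

definition col_count :: "cell set \<Rightarrow> nat \<Rightarrow> nat \<Rightarrow> nat" where
  "col_count D c r = card {s. s \<le> r \<and> (s, c) \<in> D}"

lemma card_blockers: "card (blockers D c' (r, c)) = col_count D c' r"
proof -
  have "blockers D c' (r, c) = (\<lambda>s. (s, c')) ` {s. s \<le> r \<and> (s, c') \<in> D}"
    by (auto simp: blockers_def)
  moreover have "inj_on (\<lambda>s. (s, c')) {s. s \<le> r \<and> (s, c') \<in> D}"
    by (auto simp: inj_on_def)
  ultimately show ?thesis
    by (simp add: col_count_def card_image)
qed

lemma diagram_pos: "diagram D \<Longrightarrow> (r, c) \<in> D \<Longrightarrow> 0 < r \<and> 0 < c"
  by (auto simp: diagram_def)

lemma col_count_0: "diagram D \<Longrightarrow> col_count D c 0 = 0"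
  using diagram_pos[of D 0 c] by (auto simp: col_count_def)

text \<open>Row-by-row recursion: a column has at most one cell in each row. The monotonicity and
  growth bounds on column counts follow from it by induction on the row.\<close>

lemma col_count_Suc:
  "col_count D c (Suc r) = col_count D c r + (if (Suc r, c) \<in> D then 1 else 0)"
proof -
  have "{s. s \<le> Suc r \<and> (s, c) \<in> D} =
      (if (Suc r, c) \<in> D then insert (Suc r) {s. s \<le> r \<and> (s, c) \<in> D}
       else {s. s \<le> r \<and> (s, c) \<in> D})"
    by (auto simp: le_Suc_eq)
  then show ?thesis by (simp add: col_count_def)
qed

lemma col_count_mono: "s \<le> t \<Longrightarrow> col_count D c s \<le> col_count D c t"
  by (induction t rule: dec_induct) (auto simp: col_count_Suc)

lemma col_count_le_add: "s \<le> t \<Longrightarrow> col_count D c t \<le> col_count D c s + (t - s)"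
  by (induction t rule: dec_induct) (auto simp: col_count_Suc)

lemma col_count_full:
  "s \<le> t \<Longrightarrow> (\<And>u. s < u \<Longrightarrow> u \<le> t \<Longrightarrow> (u, c) \<in> D) \<Longrightarrow>
    col_count D c t = col_count D c s + (t - s)"
  by (induction t rule: dec_induct) (auto simp: col_count_Suc)

lemma col_count_le: "diagram D \<Longrightarrow> col_count D c r \<le> r"
  using col_count_le_add[of 0 r D c] by (simp add: col_count_0)

lemma finite_col_counts: "diagram D \<Longrightarrow> finite {col_count D c' r | c'. c \<le> c'}"
  by (rule finite_subset[of _ "{..r}"]) (auto simp: col_count_le)

lemma room_eq: "room D (r, c) = int r - int (Max {col_count D c' r | c'. c \<le> c'})"
  by (simp add: room_def card_blockers)

text \<open>Together with \<open>room_attained\<close> this replaces the maximum in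
  \<open>room\<close>: every column weakly to the right bounds the room from above, and some such
  column gives equality. Later arguments only compare single columns.\<close>

lemma room_le:
  assumes "diagram D" "c \<le> c'"
  shows "room D (r, c) \<le> int r - int (col_count D c' r)"
proof -
  have "col_count D c' r \<le> Max {col_count D c' r | c'. c \<le> c'}"
    using assms by (intro Max_ge finite_col_counts) auto
  then show ?thesis by (simp add: room_eq)
qed

lemma room_attained:
  assumes "diagram D"
  obtains c' where "c \<le> c'" "room D (r, c) = int r - int (col_count D c' r)"
proof -
  have "Max {col_count D c' r | c'. c \<le> c'} \<in> {col_count D c' r | c'. c \<le> c'}"
    using assms by (intro Max_in finite_col_counts) auto
  with that show ?thesis by (auto simp: room_eq)
qed

lemma room_nonneg: "diagram D \<Longrightarrow> 0 \<le> room D (r, c)"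
  by (metis room_attained col_count_le diff_ge_0_iff_ge of_nat_mono)

section \<open>Nontrivial moves and immovable rows\<close>

text \<open>Describes the source and target of a nontrivial move by quantifiers instead of the two
  \<open>Max\<close> terms of \<open>kohnert_move\<close>. The last conjunct makes \<open>r'\<close>
  the first gap below the cell.\<close>

definition lowers :: "cell set \<Rightarrow> nat \<Rightarrow> nat \<Rightarrow> nat \<Rightarrow> bool" where
  "lowers D r c r' \<longleftrightarrow> (r, c) \<in> D \<and> (\<forall>d>c. (r, d) \<notin> D) \<and> 0 < r' \<and> r' < r \<and> (r', c) \<notin> D \<and>
     (\<forall>s. r' < s \<and> s < r \<longrightarrow> (s, c) \<in> D)"

lemma finite_row: "diagram D \<Longrightarrow> finite {c. (r, c) \<in> D}"
  by (rule finite_subset[of _ "snd ` D"]) (force simp: diagram_def)+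

lemma kohnert_move_eq:
  fixes D r
  defines "c \<equiv> Max {c. (r, c) \<in> D}"
  defines "free \<equiv> {r'. 0 < r' \<and> r' < r \<and> (r', c) \<notin> D}"
  assumes "{c. (r, c) \<in> D} \<noteq> {}" "free \<noteq> {}"
  shows "kohnert_move D r = insert (Max free, c) (D - {(r, c)})"
  unfolding kohnert_move_def Let_def c_def[symmetric] free_def[symmetric]
  using assms(3,4) by (simp only: if_False Un_insert_right Un_empty_right)

lemma kohnert_move_nontrivialE:
  assumes D: "diagram D" and nontriv: "kohnert_move D r \<noteq> D"
  obtains c r' where "lowers D r c r'" "kohnert_move D r = insert (r', c) (D - {(r, c)})"
proof -
  define c where "c = Max {c. (r, c) \<in> D}"
  define free where "free = {r'. 0 < r' \<and> r' < r \<and> (r', c) \<notin> D}"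
  have row: "{c. (r, c) \<in> D} \<noteq> {}" and free: "free \<noteq> {}"
    using nontriv by (auto simp: kohnert_move_def c_def free_def Let_def split: if_splits)
  have "(r, c) \<in> D" using Max_in[OF finite_row[OF D] row] by (simp add: c_def)
  moreover have "\<forall>d>c. (r, d) \<notin> D"
    using Max_ge[OF finite_row[OF D], of _ r] by (auto simp: c_def not_le[symmetric])
  moreover have fin: "finite free" by (simp add: free_def)
  then have "Max free \<in> free" using free by (rule Max_in)
  then have "0 < Max free" "Max free < r" "(Max free, c) \<notin> D" unfolding free_def by blast+
  moreover have "(s, c) \<in> D" if "Max free < s" "s < r" for s
  proof (rule ccontr)
    assume "(s, c) \<notin> D"
    with that have "s \<in> free" by (simp add: free_def)
    then show False using Max_ge[OF fin, of s] that by simp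
  qed
  ultimately have "lowers D r c (Max free)" by (simp add: lowers_def)
  moreover have "kohnert_move D r = insert (Max free, c) (D - {(r, c)})"
    unfolding c_def free_def
    by (intro kohnert_move_eq row free[unfolded c_def free_def])
  ultimately show ?thesis by (rule that)
qed

lemma diagram_kohnert_move:
  assumes "diagram D"
  shows "diagram (kohnert_move D r)"
proof (cases "kohnert_move D r = D")
  case False
  with assms obtain c r' where "lowers D r c r'"
    "kohnert_move D r = insert (r', c) (D - {(r, c)})"
    by (rule kohnert_move_nontrivialE)
  with assms show ?thesis by (auto simp: lowers_def diagram_def)
qed (simp add: assms)

text \<open>The rightmost cell of the row lies in a column \<open>d\<close> weakly right of
  \<open>c\<close>. As the row is immovable, column \<open>d\<close> is full up to row
  \<open>r\<close> and gives \<open>r\<close> blockers, the largest possible number.\<close>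

lemma room_eq_0_if_trivial:
  assumes D: "diagram D" and cell: "(r, c) \<in> D" and triv: "kohnert_move D r = D"
  shows "room D (r, c) = 0"
proof -
  define d where "d = Max {c. (r, c) \<in> D}"
  define free where "free = {r'. 0 < r' \<and> r' < r \<and> (r', d) \<notin> D}"
  have row: "{c. (r, c) \<in> D} \<noteq> {}" using cell by auto
  have d: "(r, d) \<in> D" using Max_in[OF finite_row[OF D] row] by (simp add: d_def)
  have "c \<le> d" unfolding d_def using cell finite_row[OF D] by (intro Max_ge) auto
  have "free = {}"
  proof (rule ccontr)
    assume ne: "free \<noteq> {}"
    have "finite free" by (simp add: free_def)
    then have "Max free \<in> free" using ne by (rule Max_in)
    then have "(r, d) \<notin> insert (Max free, d) (D - {(r, d)})" by (auto simp: free_def)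
    moreover have "kohnert_move D r = insert (Max free, d) (D - {(r, d)})"
      unfolding d_def free_def
      by (intro kohnert_move_eq row ne[unfolded d_def free_def])
    ultimately show False using triv d by metis
  qed
  then have "(u, d) \<in> D" if "0 < u" "u \<le> r" for u
    using that d by (auto simp: free_def le_less)
  then have "col_count D d r = r"
    using col_count_full[of 0 r d D] by (simp add: col_count_0[OF D])
  then show ?thesis
    using room_le[OF D \<open>c \<le> d\<close>, of r] room_nonneg[OF D, of r c] by simp
qed

section \<open>Change of room under a move\<close>

text \<open>A count up to height \<open>s\<close> notices the move only if \<open>s\<close>
  separates the new position from the old one; it then gains the landed cell without having
  contained the departed one.\<close>

lemma col_count_lowered:
  assumes D: "diagram D" and low: "lowers D r c r'"
  shows "col_count (insert (r', c) (D - {(r, c)})) d s =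
    col_count D d s + (if d = c \<and> r' \<le> s \<and> s < r then 1 else 0)"
proof -
  let ?E = "insert (r', c) (D - {(r, c)})"
  have "diagram ?E" using D low by (auto simp: lowers_def diagram_def)
  then show ?thesis
  proof (induction s)
    case 0
    then show ?case using D low by (auto simp: col_count_0 lowers_def)
  next
    case (Suc s)
    then show ?case using low by (auto simp: col_count_Suc lowers_def)
  qed
qed

text \<open>Column counts never decrease under a move, so the column that attains the old room
  already bounds the new one.\<close>

lemma room_lowered_le:
  assumes D: "diagram D" and low: "lowers D r c r'"
  shows "room (insert (r', c) (D - {(r, c)})) (s, d) \<le> room D (s, d)"
proof -
  let ?E = "insert (r', c) (D - {(r, c)})"
  have E: "diagram ?E" using D low by (auto simp: lowers_def diagram_def)
  obtain d' where "d \<le> d'" and d': "room D (s, d) = int s - int (col_count D d' s)"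
    by (rule room_attained[OF D])
  from room_le[OF E \<open>d \<le> d'\<close>, of s] show ?thesis
    by (simp add: d' col_count_lowered[OF D low])
qed

lemma room_moved_cell_less:
  assumes D: "diagram D" and low: "lowers D r c r'"
  shows "room (insert (r', c) (D - {(r, c)})) (r', c) < room D (r, c)"
proof -
  let ?E = "insert (r', c) (D - {(r, c)})"
  have E: "diagram ?E" using D low by (auto simp: lowers_def diagram_def)
  obtain q where q: "r = Suc q" using low by (cases r) (auto simp: lowers_def)
  have "r' \<le> q" using low q by (auto simp: lowers_def)
  obtain d where "c \<le> d" and d: "room D (r, c) = int r - int (col_count D d r)"
    by (rule room_attained[OF D])
  have "room ?E (r', c) \<le> int r' - int (col_count ?E d r')"
    using E \<open>c \<le> d\<close> by (rule room_le)
  \<comment> \<open>The slack is \<open>q - r'\<close>, one less than the row difference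
    \<open>r - r'\<close>; this makes the decrease strict. The saved unit is the landed cell if
    \<open>d = c\<close>, and the missing cell in row \<open>r\<close> if
    \<open>d > c\<close>.\<close>
  moreover have "col_count D d r \<le> col_count ?E d r' + (q - r')"
  proof (cases "d = c")
    case True
    have "col_count ?E c r' = col_count D c r' + 1"
      using low by (simp add: col_count_lowered[OF D low] lowers_def)
    then show ?thesis
      using col_count_le_add[of r' r D c] True \<open>r' \<le> q\<close> q by simp
  next
    case False
    then have "(r, d) \<notin> D" using low \<open>c \<le> d\<close> by (auto simp: lowers_def)
    then have "col_count D d r = col_count D d q" by (simp add: q col_count_Suc)
    moreover have "col_count ?E d r' = col_count D d r'"
      using False by (simp add: col_count_lowered[OF D low])
    ultimately show ?thesis using col_count_le_add[OF \<open>r' \<le> q\<close>, of D d] by simp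
  qed
  ultimately show ?thesis using d q \<open>r' \<le> q\<close> by linarith
qed

text \<open>Splits both totals over the same set of stationary cells, so that these can be compared
  termwise and the moved cell separately.\<close>

lemma sum_room_lowered:
  assumes D: "diagram D" and low: "lowers D r c r'" and E: "E = insert (r', c) (D - {(r, c)})"
  shows "sum (room E) E = sum (room E) (D - {(r, c)}) + room E (r', c)"
    and "sum (room D) D = sum (room D) (D - {(r, c)}) + room D (r, c)"
  using D low by (auto simp: E lowers_def diagram_def sum.remove[of D "(r, c)"])

lemma sum_room_kohnert_move:
  assumes D: "diagram D" and nontriv: "kohnert_move D r \<noteq> D"
  shows "sum (room (kohnert_move D r)) (kohnert_move D r) < sum (room D) D"
proof -
  obtain c r' where low: "lowers D r c r'"
    and E: "kohnert_move D r = insert (r', c) (D - {(r, c)})"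
    by (rule kohnert_move_nontrivialE[OF assms])
  have "sum (room (kohnert_move D r)) (D - {(r, c)}) \<le> sum (room D) (D - {(r, c)})"
    unfolding E using room_lowered_le[OF D low] by (intro sum_mono) auto
  then show ?thesis
    using room_moved_cell_less[OF D low] sum_room_lowered[OF D low E] by (simp add: E)
qed

lemma sum_room_lowest_kohnert_move:
  assumes D: "diagram D" and nontriv: "kohnert_move D r \<noteq> D"
    and lowest: "\<And>s. 0 < s \<Longrightarrow> s < r \<Longrightarrow> kohnert_move D s = D"
  shows "sum (room D) D \<le> sum (room (kohnert_move D r)) (kohnert_move D r) + 1"
proof -
  define E where "E = kohnert_move D r"
  have E: "diagram E" unfolding E_def using D by (rule diagram_kohnert_move)
  obtain c r' where low: "lowers D r c r'" and E_eq: "E = insert (r', c) (D - {(r, c)})"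
    unfolding E_def by (rule kohnert_move_nontrivialE[OF D nontriv])
  have count: "col_count E d s = col_count D d s + (if d = c \<and> r' \<le> s \<and> s < r then 1 else 0)" for d s
    unfolding E_eq using D low by (rule col_count_lowered)
  have below: "room D (s, d) = 0" if "(s, d) \<in> D" "s < r" for s d
    using room_eq_0_if_trivial[OF D that(1)] lowest that diagram_pos[OF D] by blast
  have "room D (s, d) \<le> room E (s, d)" if "(s, d) \<in> D" for s d
  proof (cases "s < r")
    case True
    then show ?thesis using below that room_nonneg[OF E] by simp
  next
    \<comment> \<open>From row \<open>r\<close> upwards the column counts before and after the move
      agree.\<close>
    case False
    obtain d' where "d \<le> d'" and "room E (s, d) = int s - int (col_count E d' s)"
      by (rule room_attained[OF E])
    then show ?thesis using room_le[OF D \<open>d \<le> d'\<close>, of s] False by (simp add: count)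
  qed
  then have "sum (room D) (D - {(r, c)}) \<le> sum (room E) (D - {(r, c)})"
    by (intro sum_mono) auto
  moreover have "room D (r, c) \<le> room E (r', c) + 1"
  proof -
    obtain q where q: "r = Suc q" using low by (cases r) (auto simp: lowers_def)
    show ?thesis
    proof (cases "r' = q")
      case True
      obtain d where "c \<le> d" and d: "room E (r', c) = int r' - int (col_count E d r')"
        by (rule room_attained[OF E])
      \<comment> \<open>In column \<open>c\<close> the cell landed in row \<open>q\<close> makes up
        for the one that left row \<open>r\<close>.\<close>
      have "col_count E d q \<le> col_count D d r"
        using low q True by (auto simp: count col_count_Suc lowers_def)
      then show ?thesis using room_le[OF D \<open>c \<le> d\<close>, of r] d q True by simp
    next
      case False
      \<comment> \<open>The first gap is lower, so the cell directly under \<open>(r, c)\<close> is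
        present and has room zero. Some column weakly to the right thus has \<open>q\<close>
        blockers, which leaves room at most 1 for \<open>(r, c)\<close>; nonnegativity of the new
        room suffices.\<close>
      then have "(q, c) \<in> D" using low q by (auto simp: lowers_def)
      then have "room D (q, c) = 0" using below q by simp
      moreover obtain d where "c \<le> d" and d: "room D (q, c) = int q - int (col_count D d q)"
        by (rule room_attained[OF D])
      ultimately have "q \<le> col_count D d r" using col_count_mono[of q r D d] q by simp
      then show ?thesis
        using room_le[OF D \<open>c \<le> d\<close>, of r] room_nonneg[OF E, of r' c] q by simp
    qed
  qed
  ultimately show ?thesis
    using sum_room_lowered[OF D low E_eq] unfolding E_def by simp
qed

section \<open>Upper bound and greedy sequence\<close>

lemma sum_room_nonneg: "diagram D \<Longrightarrow> 0 \<le> sum (room D) D"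
  by (intro sum_nonneg) (auto simp: room_nonneg)

lemma length_nontrivial_moves_le:
  "diagram D \<Longrightarrow> nontrivial_moves D rs \<Longrightarrow> int (length rs) \<le> sum (room D) D"
proof (induction rs arbitrary: D)
  case Nil
  then show ?case by (simp add: sum_room_nonneg)
next
  case (Cons r rs)
  then have "int (length rs) \<le> sum (room (kohnert_move D r)) (kohnert_move D r)"
    by (intro Cons.IH diagram_kohnert_move) auto
  also have "\<dots> < sum (room D) D"
    using Cons.prems by (intro sum_room_kohnert_move) auto
  finally show ?case by simp
qed

lemma nontrivial_moves_pos: "nontrivial_moves D rs \<Longrightarrow> set rs \<subseteq> {0<..}"
  by (induction D rs rule: nontrivial_moves.induct) auto

text \<open>Greedy choice of the lowest movable row costs exactly one unit of total room per move,
  so induction on the total applies. The sequence stops only when all rows are immovable, and then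
  the total is zero.\<close>

lemma ex_nontrivial_moves_attaining:
  assumes "diagram D"
  shows "\<exists>rs. nontrivial_moves D rs \<and> int (length rs) = sum (room D) D \<and>
    (\<forall>r>0. kohnert_move (foldl kohnert_move D rs) r = foldl kohnert_move D rs)"
  using assms
proof (induction "nat (sum (room D) D)" arbitrary: D rule: less_induct)
  case less
  note D = \<open>diagram D\<close>
  show ?case
  proof (cases "\<forall>r>0. kohnert_move D r = D")
    case True
    then have "room D x = 0" if "x \<in> D" for x
      using that room_eq_0_if_trivial[OF D] diagram_pos[OF D] by (cases x) blast
    then show ?thesis using True by (intro exI[of _ "[]"]) simp
  next
    case False
    define r where "r = (LEAST r. 0 < r \<and> kohnert_move D r \<noteq> D)"
    have r: "0 < r" "kohnert_move D r \<noteq> D"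
      using False LeastI_ex[of "\<lambda>r. 0 < r \<and> kohnert_move D r \<noteq> D"] by (auto simp: r_def)
    have lowest: "kohnert_move D s = D" if "0 < s" "s < r" for s
      using that not_less_Least unfolding r_def by blast
    define E where "E = kohnert_move D r"
    have E: "diagram E" unfolding E_def using D by (rule diagram_kohnert_move)
    have total: "sum (room D) D = sum (room E) E + 1"
      using sum_room_kohnert_move[OF D r(2)] sum_room_lowest_kohnert_move[OF D r(2) lowest]
      by (simp add: E_def)
    then obtain rs where "nontrivial_moves E rs" "int (length rs) = sum (room E) E"
      "\<forall>r>0. kohnert_move (foldl kohnert_move E rs) r = foldl kohnert_move E rs"
      using less.hyps[of E] E sum_room_nonneg[OF E] by auto
    then show ?thesis using r total by (intro exI[of _ "r # rs"]) (simp add: E_def)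
  qed
qed

theorem theorem3p1:
  fixes D :: "(nat \<times> nat) set"
  assumes "diagram D"
  shows "int (MC D) = (\<Sum>x\<in>D. room D x)"
proof -
  let ?S = "{length rs | rs. nontrivial_moves D rs \<and> foldl kohnert_move D rs \<in> Min_diagrams D}"
  obtain rs where rs: "nontrivial_moves D rs" "int (length rs) = sum (room D) D"
    "\<forall>r>0. kohnert_move (foldl kohnert_move D rs) r = foldl kohnert_move D rs"
    using ex_nontrivial_moves_attaining[OF assms] by blast
  \<comment> \<open>Besides maximality of \<open>length rs\<close>, this bound yields finiteness of
    the set, which \<open>Max\<close> requires.\<close>
  have upper: "n \<le> length rs" if "n \<in> ?S" for n
    using that length_nontrivial_moves_le[OF assms] rs(2) by fastforce
  have "foldl kohnert_move D rs \<in> Min_diagrams D"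
    using rs(3) nontrivial_moves_pos[OF rs(1)] unfolding Min_diagrams_def KD_def by blast
  with rs(1) have "length rs \<in> ?S" by blast
  moreover have "finite ?S"
    using upper by (intro finite_subset[of ?S "{..length rs}"]) auto
  ultimately have "MC D = length rs"
    unfolding MC_def using upper by (intro Max_eqI)
  then show ?thesis using rs(2) by simp
qed

end
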